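(* Let $r>k\ge 1$ be integers, let $X$ be an $r$-ample simplicial complex, and let $Y$ be obtained from $X$ by removing a finite set $\mathcal{F}$ of simplices of $X$. Then $Y$ is $(r-k)$-ample provided that $$|\mathcal{F}|+\dim(\mathcal{F})\;<\;M'(k)+k .$$ In particular, $Y$ is $(r-k)$-ample if $$|\mathcal{F}|+\dim(\mathcal{F})\;<\;2^{\binom{k}{\lfloor k/2\rfloor}}+k .$$
   Context: For a simplicial complex $X$, $V(X)$ is its vertex set; for $U\subseteq V(X)$, $X_U$ is the induced subcomplex on $U$ (vertex set $U$, whose simplices are exactly the simplices of $X$ with all vertices in $U$). For a vertex $v$, the link ${\rm lk}_X(v)$ is the subcomplex of all simplices $\sigma$ of $X$ with $v\notin\sigma$ such that $\sigma\cup\{v\}$ is a simplex of $X$. Simplices are nonempty; subcomplexes are allowed to be empty. For an integer $r\ge 1$, a nonempty simplicial complex $X$ is $r$-ample if for each $U\subseteq V(X)$ with $|U|\le r$ and each subcomplex $A\subseteq X_U$ (possibly empty) there is a vertex $v\in V(X)\setminus U$ with ${\rm lk}_X(v)\cap X_U=A$. For a finite set $\mathcal{F}$ of simplices of $X$, the complex $Y$ obtained from $X$ by removing $\mathcal{F}$ is the complex obtained by removing all simplices of $\mathcal{F}$ as well as all simplices which have a face belonging to $\mathcal{F}$ (vertices that belong to $\mathcal F$ as $0$-simplices are no longer vertices of $Y$). $|\mathcal{F}|$ is the cardinality of $\mathcal{F}$ and $\dim(\mathcal{F})=\sum_{\sigma\in\mathcal{F}}\dim\sigma$. $M'(n)$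 denotes the number of simplicial complexes with vertices from the set $\{1,\dots,n\}$ (i.e. the number of subcomplexes, including the empty one, of the full simplex on $\{1,\dots,n\}$); e.g. $M'(1)=2$, $M'(2)=5$, $M'(3)=19$. *)

theory Defs
  imports Complex_Main
begin

text \<open>
  Abstract simplicial complexes, given by their sets of simplices. Simplices are finite and
  nonempty; the complex itself may be empty or infinite. Subcomplexes of \<open>X\<close> are the
  simplicial complexes \<open>A\<close> with \<open>A \<subseteq> X\<close>.
\<close>

definition simplicial_complex :: "'a set set \<Rightarrow> bool" where
  "simplicial_complex X \<longleftrightarrow>
     (\<forall>\<sigma>\<in>X. finite \<sigma> \<and> \<sigma> \<noteq> {} \<and> (\<forall>\<tau>. \<tau> \<noteq> {} \<and> \<tau> \<subseteq> \<sigma> \<longrightarrow> \<tau> \<in> X))"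

definition vertices :: "'a set set \<Rightarrow> 'a set" where
  "vertices X = {v. {v} \<in> X}"

definition induced :: "'a set set \<Rightarrow> 'a set \<Rightarrow> 'a set set" where
  "induced X U = {\<sigma> \<in> X. \<sigma> \<subseteq> U}"

definition link :: "'a set set \<Rightarrow> 'a \<Rightarrow> 'a set set" where
  "link X v = {\<sigma> \<in> X. v \<notin> \<sigma> \<and> insert v \<sigma> \<in> X}"

text \<open>The condition \<open>finite U\<close> is needed since \<open>card\<close> is \<open>0\<close> on infinite sets.\<close>

definition ample :: "nat \<Rightarrow> 'a set set \<Rightarrow> bool" where
  "ample r X \<longleftrightarrow> simplicial_complex X \<and> X \<noteq> {} \<and>
     (\<forall>U A. U \<subseteq> vertices X \<and> finite U \<and> card U \<le> r \<and>
            simplicial_complex A \<and> A \<subseteq> induced X U \<longrightarrow>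
        (\<exists>v \<in> vertices X - U. link X v \<inter> induced X U = A))"

definition remove_simplices :: "'a set set \<Rightarrow> 'a set set \<Rightarrow> 'a set set" where
  "remove_simplices X F = {\<sigma> \<in> X. \<not> (\<exists>\<tau>\<in>F. \<tau> \<subseteq> \<sigma>)}"

text \<open>Truncated subtraction is harmless here, as simplices are nonempty.\<close>

definition simplex_dim :: "'a set \<Rightarrow> nat" where
  "simplex_dim \<sigma> = card \<sigma> - 1"

definition family_dim :: "'a set set \<Rightarrow> nat" where
  "family_dim F = (\<Sum>\<sigma>\<in>F. simplex_dim \<sigma>)"

text \<open>
  The number \<open>M'(n)\<close> of simplicial complexes with vertices from \<open>{1,\<dots>,n}\<close>; not every element
  of \<open>{1,\<dots>,n}\<close> has to be a vertex, and the empty complex is counted.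
\<close>

definition num_complexes :: "nat \<Rightarrow> nat" where
  "num_complexes n = card {A :: nat set set. simplicial_complex A \<and> vertices A \<subseteq> {1..n}}"

end

theory Submission
  imports Defs
begin

text \<open>
  Let \<open>C\<close> be the set of vertices \<open>v\<close> of \<open>X\<close> outside \<open>U\<close> whose link meets \<open>X\<^sub>U\<close> in \<open>A\<close>. Every
  member of \<open>C\<close> that lies on no simplex of \<open>F\<close> witnesses ampleness of \<open>Y\<close>, and the simplices
  of \<open>F\<close> have at most \<open>|F| + dim F\<close> vertices, so it suffices that \<open>C\<close> has at least
  \<open>M'(k) + k\<close> elements. Ampleness yields, one vertex at a time, a set \<open>W \<subseteq> C\<close> of \<open>k\<close> vertices
  spanning a simplex. Each of the \<open>M'(k)\<close> subcomplexes \<open>B\<close> of this simplex gives another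
  element of \<open>C\<close>, outside \<open>W\<close>, namely a vertex whose link meets \<open>X\<^sub>U\<^sub>\<union>\<^sub>W\<close> in \<open>A \<union> B\<close>.
\<close>

section \<open>Closure properties of simplicial complexes\<close>

lemma simplicial_complexI:
  assumes "\<And>\<sigma>. \<sigma> \<in> X \<Longrightarrow> finite \<sigma>" "\<And>\<sigma>. \<sigma> \<in> X \<Longrightarrow> \<sigma> \<noteq> {}"
    and "\<And>\<sigma> \<tau>. \<sigma> \<in> X \<Longrightarrow> \<tau> \<noteq> {} \<Longrightarrow> \<tau> \<subseteq> \<sigma> \<Longrightarrow> \<tau> \<in> X"
  shows "simplicial_complex X"
  unfolding simplicial_complex_def
proof (intro ballI conjI allI impI)
  fix \<sigma> assume "\<sigma> \<in> X"
  then show "finite \<sigma>" "\<sigma> \<noteq> {}" by (rule assms)+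
  show "\<tau> \<in> X" if "\<tau> \<noteq> {} \<and> \<tau> \<subseteq> \<sigma>" for \<tau>
    using assms(3)[OF \<open>\<sigma> \<in> X\<close>] that by (elim conjE)
qed

lemma
  assumes "simplicial_complex X" "\<sigma> \<in> X"
  shows simplicial_complex_finite: "finite \<sigma>"
    and simplicial_complex_nonempty: "\<sigma> \<noteq> {}"
    and simplicial_complex_face: "\<And>\<tau>. \<tau> \<noteq> {} \<Longrightarrow> \<tau> \<subseteq> \<sigma> \<Longrightarrow> \<tau> \<in> X"
  using assms unfolding simplicial_complex_def by blast+

lemma simplicial_complex_Un:
  assumes "simplicial_complex A" "simplicial_complex B"
  shows "simplicial_complex (A \<union> B)"
proof (rule simplicial_complexI)
  show "finite \<sigma>" "\<sigma> \<noteq> {}" if "\<sigma> \<in> A \<union> B" for \<sigma>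
    using that assms simplicial_complex_finite simplicial_complex_nonempty by (metis Un_iff)+
  show "\<tau> \<in> A \<union> B" if "\<sigma> \<in> A \<union> B" "\<tau> \<noteq> {}" "\<tau> \<subseteq> \<sigma>" for \<sigma> \<tau>
    using that assms simplicial_complex_face by (metis Un_iff)
qed

lemma simplicial_complex_induced:
  assumes "simplicial_complex X"
  shows "simplicial_complex (induced X U)"
proof (rule simplicial_complexI)
  show "finite \<sigma>" "\<sigma> \<noteq> {}" if "\<sigma> \<in> induced X U" for \<sigma>
    using that assms simplicial_complex_finite simplicial_complex_nonempty
    unfolding induced_def by blast+
  show "\<tau> \<in> induced X U" if "\<sigma> \<in> induced X U" "\<tau> \<noteq> {}" "\<tau> \<subseteq> \<sigma>" for \<sigma> \<tau>
    using that simplicial_complex_face[OF assms] unfolding induced_def by auto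
qed

lemma simplicial_complex_remove_simplices:
  assumes "simplicial_complex X"
  shows "simplicial_complex (remove_simplices X F)"
proof (rule simplicial_complexI)
  show "finite \<sigma>" "\<sigma> \<noteq> {}" if "\<sigma> \<in> remove_simplices X F" for \<sigma>
    using that assms simplicial_complex_finite simplicial_complex_nonempty
    unfolding remove_simplices_def by blast+
  show "\<tau> \<in> remove_simplices X F"
    if "\<sigma> \<in> remove_simplices X F" "\<tau> \<noteq> {}" "\<tau> \<subseteq> \<sigma>" for \<sigma> \<tau>
  proof -
    have "\<sigma> \<in> X" and "\<And>\<rho>. \<rho> \<in> F \<Longrightarrow> \<not> \<rho> \<subseteq> \<sigma>"
      using that(1) unfolding remove_simplices_def by blast+
    moreover from this have "\<tau> \<in> X" using simplicial_complex_face[OF assms] that(2,3) by blast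
    ultimately show ?thesis using \<open>\<tau> \<subseteq> \<sigma>\<close> unfolding remove_simplices_def by blast
  qed
qed

lemma simplicial_complex_image:
  assumes "simplicial_complex A"
  shows "simplicial_complex ((`) f ` A)"
  unfolding simplicial_complex_def
proof (intro ballI conjI allI impI)
  fix \<sigma> assume "\<sigma> \<in> (`) f ` A"
  then obtain \<rho> where \<rho>: "\<rho> \<in> A" "\<sigma> = f ` \<rho>" by blast
  then show "finite \<sigma>" "\<sigma> \<noteq> {}"
    using simplicial_complex_finite[OF assms] simplicial_complex_nonempty[OF assms] by auto
  fix \<tau> assume \<tau>: "\<tau> \<noteq> {} \<and> \<tau> \<subseteq> \<sigma>"
  then obtain \<rho>' where "\<rho>' \<subseteq> \<rho>" "\<tau> = f ` \<rho>'"
    using \<rho>(2) by (auto simp: subset_image_iff)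
  moreover from this have "\<rho>' \<in> A"
    using simplicial_complex_face[OF assms \<rho>(1)] \<tau> by blast
  ultimately show "\<tau> \<in> (`) f ` A" by blast
qed

section \<open>Counting complexes on a finite vertex set\<close>

lemma vertices_subset_iff:
  assumes "simplicial_complex A"
  shows "vertices A \<subseteq> S \<longleftrightarrow> (\<forall>\<sigma>\<in>A. \<sigma> \<subseteq> S)"
proof
  assume V: "vertices A \<subseteq> S"
  show "\<forall>\<sigma>\<in>A. \<sigma> \<subseteq> S"
  proof (intro ballI subsetI)
    fix \<sigma> x assume "\<sigma> \<in> A" "x \<in> \<sigma>"
    then have "{x} \<in> A" using simplicial_complex_face[OF assms] by blast
    then show "x \<in> S" using V by (auto simp: vertices_def)
  qed
qed (auto simp: vertices_def)

lemma finite_complexes: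
  assumes "finite S"
  shows "finite {A. simplicial_complex A \<and> vertices A \<subseteq> S}"
proof (rule finite_subset)
  show "{A. simplicial_complex A \<and> vertices A \<subseteq> S} \<subseteq> Pow (Pow S)"
    using vertices_subset_iff by blast
qed (use assms in simp)

text \<open>Relabelling vertices along a bijection from \<open>{1..card W}\<close> to
  \<open>W\<close> keeps distinct complexes distinct. This carries the count from numbers over to a
  set of vertices of \<open>X\<close>.\<close>

lemma num_complexes_le_card:
  assumes "finite W"
  shows "num_complexes (card W) \<le> card {B. simplicial_complex B \<and> vertices B \<subseteq> W}"
proof -
  obtain f where f: "bij_betw f {1..card W} W"
    using ex_bij_betw_nat_finite_1[OF assms] by blast
  have inj: "inj_on f {1..card W}" and im: "f ` {1..card W} = W"
    using f by (auto simp: bij_betw_def)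
  let ?N = "{A. simplicial_complex A \<and> vertices A \<subseteq> {1..card W}}"
  have "inj_on ((`) ((`) f)) ?N"
  proof (rule inj_on_subset)
    show "inj_on ((`) ((`) f)) (Pow (Pow {1..card W}))"
      by (intro inj_on_image_Pow inj)
    show "?N \<subseteq> Pow (Pow {1..card W})"
      using vertices_subset_iff by blast
  qed
  moreover have "(`) ((`) f) ` ?N \<subseteq> {B. simplicial_complex B \<and> vertices B \<subseteq> W}"
  proof clarsimp
    fix A assume A: "simplicial_complex A" "vertices A \<subseteq> {Suc 0..card W}"
    then have "\<forall>\<sigma>\<in>A. \<sigma> \<subseteq> {1..card W}"
      using vertices_subset_iff[OF A(1), of "{1..card W}"] by simp
    then have "\<forall>\<sigma>\<in>(`) f ` A. \<sigma> \<subseteq> W" using im by blast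
    then show "simplicial_complex ((`) f ` A) \<and> vertices ((`) f ` A) \<subseteq> W"
      using simplicial_complex_image[OF A(1), of f] vertices_subset_iff by blast
  qed
  ultimately show ?thesis
    unfolding num_complexes_def by (intro card_inj_on_le finite_complexes assms)
qed

text \<open>The complete skeleton formed by all nonempty sets of fewer than \<open>m\<close> points
  (\<open>L\<close>) stays a complex after adding any family of \<open>m\<close>-point sets (a
  subset of \<open>S\<close>), and different families give different complexes. For
  \<open>m = 0\<close> the only set in \<open>S\<close> would be empty, hence no simplex.\<close>

lemma two_power_choose_le_num_complexes:
  assumes "m \<ge> 1"
  shows "2 ^ (k choose m) \<le> num_complexes k"
proof -
  define L where "L = {\<sigma>. \<sigma> \<subseteq> {1..k} \<and> \<sigma> \<noteq> {} \<and> card \<sigma> < m}"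
  define S where "S = {\<sigma>. \<sigma> \<subseteq> {1..k} \<and> card \<sigma> = m}"
  have finS: "finite S" unfolding S_def by simp
  have "card (Pow S) = 2 ^ (k choose m)"
    using n_subsets[of "{1..k}" m] finS by (simp add: card_Pow S_def)
  moreover have "card (Pow S) \<le> num_complexes k"
    unfolding num_complexes_def
  proof (rule card_inj_on_le[where f = "\<lambda>T. L \<union> T"])
    have "L \<inter> S = {}" by (auto simp: L_def S_def)
    then have "(L \<union> T) \<inter> S = T" if "T \<in> Pow S" for T using that by blast
    then show "inj_on (\<lambda>T. L \<union> T) (Pow S)" by (rule inj_on_inverseI)
    show "(\<lambda>T. L \<union> T) ` Pow S \<subseteq> {A. simplicial_complex A \<and> vertices A \<subseteq> {1..k}}"
    proof clarify
      fix T assume T: "T \<subseteq> S"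
      have sub: "\<forall>\<sigma>\<in>L \<union> T. \<sigma> \<subseteq> {1..k}" using T by (auto simp: L_def S_def)
      have "simplicial_complex (L \<union> T)"
        unfolding simplicial_complex_def
      proof (intro ballI conjI allI impI)
        fix \<sigma> assume \<sigma>: "\<sigma> \<in> L \<union> T"
        show fin: "finite \<sigma>" using sub \<sigma> finite_subset by blast
        show "\<sigma> \<noteq> {}" using \<sigma> T assms by (auto simp: L_def S_def)
        fix \<tau> assume \<tau>: "\<tau> \<noteq> {} \<and> \<tau> \<subseteq> \<sigma>"
        show "\<tau> \<in> L \<union> T"
        \<comment> \<open>A proper face has fewer than \<open>m\<close> points, so it lies in
          \<open>L\<close> whatever \<open>T\<close> is.\<close>
        proof (cases "\<tau> = \<sigma>")
          case False
          then have "card \<tau> < card \<sigma>" using \<tau> fin by (intro psubset_card_mono) auto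
          moreover have "card \<sigma> \<le> m" using \<sigma> T by (auto simp: L_def S_def)
          moreover have "\<tau> \<subseteq> {1..k}" using \<tau> sub \<sigma> by (meson order.trans)
          ultimately show ?thesis using \<tau> by (simp add: L_def)
        qed (use \<sigma> in simp)
      qed
      then show "simplicial_complex (L \<union> T) \<and> vertices (L \<union> T) \<subseteq> {1..k}"
        using vertices_subset_iff sub by blast
    qed
  qed (simp add: finite_complexes)
  ultimately show ?thesis by simp
qed

section \<open>Vertices with a prescribed link\<close>

definition link_witnesses :: "'a set set \<Rightarrow> 'a set \<Rightarrow> 'a set set \<Rightarrow> 'a set" where
  "link_witnesses X U A = {v \<in> vertices X - U. link X v \<inter> induced X U = A}"

text \<open>Ampleness is applied to \<open>U \<union> W\<close> and \<open>A \<union> B\<close>. As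
  \<open>U\<close> and \<open>W\<close> are disjoint and simplices are nonempty, restricting the
  link to \<open>U\<close> leaves exactly \<open>A\<close>, and restricting it to \<open>W\<close>
  leaves exactly \<open>B\<close>.\<close>

lemma ample_disjoint_witness:
  assumes "ample r X" "U \<subseteq> vertices X" "W \<subseteq> vertices X" "finite U" "finite W"
    and "U \<inter> W = {}" "card U + card W \<le> r"
    and A: "simplicial_complex A" "A \<subseteq> induced X U"
    and B: "simplicial_complex B" "B \<subseteq> induced X W"
  shows "\<exists>v. v \<in> link_witnesses X U A \<and> v \<in> link_witnesses X W B"
proof -
  have "A \<union> B \<subseteq> induced X (U \<union> W)" using A B unfolding induced_def by blast
  moreover have "card (U \<union> W) \<le> r"
    using assms by (simp add: card_Un_disjoint)
  ultimately obtain v where v: "v \<in> vertices X - (U \<union> W)"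
    "link X v \<inter> induced X (U \<union> W) = A \<union> B"
    using assms simplicial_complex_Un[OF A(1) B(1)] unfolding ample_def
    by (metis Un_least finite_Un)
  have AU: "\<sigma> \<subseteq> U" "\<sigma> \<noteq> {}" if "\<sigma> \<in> A" for \<sigma>
    using that A simplicial_complex_nonempty unfolding induced_def by blast+
  have BW: "\<sigma> \<subseteq> W" "\<sigma> \<noteq> {}" if "\<sigma> \<in> B" for \<sigma>
    using that B simplicial_complex_nonempty unfolding induced_def by blast+
  have BU: "\<not> \<sigma> \<subseteq> U" if "\<sigma> \<in> B" for \<sigma>
    using BW[OF that] \<open>U \<inter> W = {}\<close> by blast
  have AW: "\<not> \<sigma> \<subseteq> W" if "\<sigma> \<in> A" for \<sigma>
    using AU[OF that] \<open>U \<inter> W = {}\<close> by blast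
  have "link X v \<inter> induced X U = (A \<union> B) \<inter> {\<sigma>. \<sigma> \<subseteq> U}"
    unfolding v(2)[symmetric] induced_def by blast
  also have "\<dots> = A"
    using AU(1) BU by auto
  finally have 1: "link X v \<inter> induced X U = A" .
  have "link X v \<inter> induced X W = (A \<union> B) \<inter> {\<sigma>. \<sigma> \<subseteq> W}"
    unfolding v(2)[symmetric] induced_def by blast
  also have "\<dots> = B"
    using BW(1) AW by auto
  finally show ?thesis using 1 v(1) unfolding link_witnesses_def by blast
qed

text \<open>Induction on the number of vertices: the next witness is chosen so that its link also
  contains every face of the simplex built so far, which makes the enlarged set a simplex
  again.\<close>

lemma ample_simplex_of_witnesses:
  assumes X: "ample r X" and U: "U \<subseteq> vertices X" "finite U" "card U + i \<le> r"
    and A: "simplicial_complex A" "A \<subseteq> induced X U"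
  shows "\<exists>W \<subseteq> link_witnesses X U A. finite W \<and> card W = i \<and> (\<forall>\<sigma>\<subseteq>W. \<sigma> \<noteq> {} \<longrightarrow> \<sigma> \<in> X)"
  using U(3)
proof (induction i)
  case 0
  show ?case by (rule exI[of _ "{}"]) simp
next
  case (Suc i)
  then obtain W where W: "W \<subseteq> link_witnesses X U A" "finite W" "card W = i"
    "\<And>\<sigma>. \<sigma> \<subseteq> W \<Longrightarrow> \<sigma> \<noteq> {} \<Longrightarrow> \<sigma> \<in> X" by auto
  have WX: "W \<subseteq> vertices X" "U \<inter> W = {}" using W(1) unfolding link_witnesses_def by auto
  have sc: "simplicial_complex (induced X W)"
    using X simplicial_complex_induced unfolding ample_def by blast
  \<comment> \<open>Prescribing all of \<open>induced X W\<close> on \<open>W\<close> makes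
    \<open>v\<close> a cone point over the simplex on \<open>W\<close>.\<close>
  obtain v where v: "v \<in> link_witnesses X U A" "v \<in> link_witnesses X W (induced X W)"
    using ample_disjoint_witness[OF X U(1) WX(1) U(2) W(2) WX(2) _ A sc] Suc.prems W(3) by auto
  have "\<sigma> \<in> X" if \<sigma>: "\<sigma> \<subseteq> insert v W" "\<sigma> \<noteq> {}" for \<sigma>
  proof (cases "v \<in> \<sigma>")
    case False
    then show ?thesis using \<sigma> W(4) by blast
  next
    case True
    show ?thesis
    proof (cases "\<sigma> = {v}")
      case True
      then show ?thesis using v(1) by (simp add: link_witnesses_def vertices_def)
    next
      case False
      have "\<sigma> - {v} \<in> induced X W"
        using False True \<sigma> W(4)[of "\<sigma> - {v}"] unfolding induced_def by blast
      then have "\<sigma> - {v} \<in> link X v" using v(2) unfolding link_witnesses_def by blast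
      then show ?thesis using True by (simp add: link_def insert_absorb)
    qed
  qed
  moreover have "v \<notin> W" using v(2) unfolding link_witnesses_def by blast
  ultimately show ?case
    using v(1) W by (intro exI[of _ "insert v W"]) auto
qed

text \<open>Finiteness of the witness set is assumed because \<open>card\<close> of an infinite set
  is \<open>0\<close>; in the application it follows from containment in the finite set
  \<open>\<Union>F\<close>.\<close>

lemma card_link_witnesses_ge:
  assumes X: "ample r X" and U: "U \<subseteq> vertices X" "finite U" "card U + k \<le> r"
    and A: "simplicial_complex A" "A \<subseteq> induced X U"
    and fin: "finite (link_witnesses X U A)"
  shows "num_complexes k + k \<le> card (link_witnesses X U A)"
proof -
  let ?C = "link_witnesses X U A"
  obtain W where W: "W \<subseteq> ?C" "finite W" "card W = k"
    "\<And>\<sigma>. \<sigma> \<subseteq> W \<Longrightarrow> \<sigma> \<noteq> {} \<Longrightarrow> \<sigma> \<in> X"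
    using ample_simplex_of_witnesses[OF X U A] by blast
  have WX: "W \<subseteq> vertices X" "U \<inter> W = {}" using W(1) unfolding link_witnesses_def by auto
  let ?N = "{B. simplicial_complex B \<and> vertices B \<subseteq> W}"
  have "\<exists>v. v \<in> ?C \<and> v \<in> link_witnesses X W B" if "B \<in> ?N" for B
  proof (rule ample_disjoint_witness[OF X U(1) WX(1) U(2) W(2) WX(2) _ A])
    show "card U + card W \<le> r" using U W by simp
    show B: "simplicial_complex B" using that by simp
    have "\<forall>\<sigma>\<in>B. \<sigma> \<subseteq> W" using that vertices_subset_iff[OF B] by simp
    moreover have "{} \<notin> B" using simplicial_complex_nonempty[OF B] by blast
    ultimately show "B \<subseteq> induced X W" using W(4) unfolding induced_def by blast
  qed
  then obtain g where g: "\<And>B. B \<in> ?N \<Longrightarrow> g B \<in> ?C \<and> g B \<in> link_witnesses X W B"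
    by metis
  \<comment> \<open>The vertex \<open>g B\<close> determines \<open>B\<close>, as the intersection
    of its link with \<open>induced X W\<close>.\<close>
  have "inj_on g ?N"
  proof (rule inj_onI)
    fix B B' assume "B \<in> ?N" "B' \<in> ?N" "g B = g B'"
    then show "B = B'" using g[of B] g[of B'] unfolding link_witnesses_def by auto
  qed
  \<comment> \<open>Witnesses for \<open>W\<close> lie outside \<open>W\<close>, so the
    \<open>k\<close> vertices of \<open>W\<close> are counted in addition to the values of
    \<open>g\<close>; this is the summand \<open>k\<close> in the bound.\<close>
  moreover have "g ` ?N \<subseteq> ?C - W" using g unfolding link_witnesses_def by blast
  ultimately have "card ?N \<le> card (?C - W)"
    using fin by (intro card_inj_on_le) auto
  also have "\<dots> = card ?C - k" using W by (simp add: card_Diff_subset)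
  finally have "num_complexes k \<le> card ?C - k"
    using num_complexes_le_card[OF W(2)] W(3) by simp
  moreover have "k \<le> card ?C" using W fin card_mono by blast
  ultimately show ?thesis by simp
qed

section \<open>Ampleness after removing simplices\<close>

lemma card_Union_simplices_le:
  assumes "finite F" "\<And>\<sigma>. \<sigma> \<in> F \<Longrightarrow> finite \<sigma> \<and> \<sigma> \<noteq> {}"
  shows "card (\<Union>F) \<le> card F + family_dim F"
proof -
  have "card (\<Union>F) \<le> (\<Sum>\<sigma>\<in>F. card \<sigma>)"
    using card_Union_le_sum_card[of F] by simp
  also have "\<dots> = (\<Sum>\<sigma>\<in>F. 1 + simplex_dim \<sigma>)"
  proof (rule sum.cong)
    fix \<sigma> assume "\<sigma> \<in> F"
    \<comment> \<open>Positivity makes the truncated subtraction in \<open>simplex_dim\<close>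
      exact.\<close>
    then have "card \<sigma> > 0" using assms(2) by (simp add: card_gt_0_iff)
    then show "card \<sigma> = 1 + simplex_dim \<sigma>" by (simp add: simplex_dim_def)
  qed simp
  also have "\<dots> = card F + family_dim F"
    by (simp only: sum.distrib family_dim_def card_eq_sum)
  finally show ?thesis .
qed

text \<open>No member of \<open>F\<close> contains \<open>v\<close>, so a member inside
  \<open>insert v \<sigma>\<close> already lies inside \<open>\<sigma>\<close>. The link of
  \<open>v\<close> thus loses only simplices that are themselves removed, and those of
  \<open>A\<close> survive by assumption.\<close>

lemma link_witness_remove_simplices:
  assumes X: "simplicial_complex X" "F \<subseteq> X"
    and A: "A \<subseteq> induced (remove_simplices X F) U"
    and v: "v \<in> link_witnesses X U A" "v \<notin> \<Union>F"
  shows "v \<in> link_witnesses (remove_simplices X F) U A"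
proof -
  let ?Y = "remove_simplices X F"
  \<comment> \<open>An empty member of \<open>F\<close> would delete everything. Without it, only
    \<open>{v}\<close> itself could delete the vertex \<open>v\<close>, and \<open>v\<close> lies
    outside \<open>\<Union>F\<close>.\<close>
  have "{} \<notin> F" using X simplicial_complex_nonempty by blast
  then have "v \<in> vertices ?Y"
    using v unfolding link_witnesses_def vertices_def remove_simplices_def
    by (auto simp: subset_singleton_iff)
  moreover have "insert v \<sigma> \<in> ?Y \<longleftrightarrow> insert v \<sigma> \<in> X" if "\<sigma> \<in> ?Y" for \<sigma>
    using that v(2) unfolding remove_simplices_def by blast
  then have "link ?Y v \<inter> induced ?Y U = link X v \<inter> induced X U \<inter> ?Y"
    unfolding link_def induced_def remove_simplices_def by blast
  then have "link ?Y v \<inter> induced ?Y U = A"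
    using v(1) A unfolding link_witnesses_def induced_def by blast
  ultimately show ?thesis using v(1) unfolding link_witnesses_def by blast
qed

lemma ample_remove_simplices:
  assumes X: "ample r X" and "k \<le> r" and F: "finite F" "F \<subseteq> X"
    and less: "card F + family_dim F < num_complexes k + k"
  shows "ample (r - k) (remove_simplices X F)"
proof -
  let ?Y = "remove_simplices X F"
  have sc: "simplicial_complex X" using X unfolding ample_def by blast
  have simp: "finite \<sigma> \<and> \<sigma> \<noteq> {}" if "\<sigma> \<in> F" for \<sigma>
    using that F(2) simplicial_complex_finite[OF sc] simplicial_complex_nonempty[OF sc] by blast
  have finF: "finite (\<Union>F)" using F simp by blast
  have YX: "vertices ?Y \<subseteq> vertices X" "\<And>U. induced ?Y U \<subseteq> induced X U"
    unfolding vertices_def induced_def remove_simplices_def by auto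
  have ex: "\<exists>v. v \<in> link_witnesses ?Y U A"
    if U: "U \<subseteq> vertices ?Y" "finite U" "card U \<le> r - k"
      and A: "simplicial_complex A" "A \<subseteq> induced ?Y U" for U A
  proof -
    have "\<not> link_witnesses X U A \<subseteq> \<Union>F"
    proof
      assume sub: "link_witnesses X U A \<subseteq> \<Union>F"
      have "num_complexes k + k \<le> card (link_witnesses X U A)"
      proof (rule card_link_witnesses_ge[OF X])
        show "U \<subseteq> vertices X" "A \<subseteq> induced X U" using U(1) A(2) YX by (meson order.trans)+
        show "card U + k \<le> r" using U(3) \<open>k \<le> r\<close> by simp
      qed (use U(2) A(1) finite_subset[OF sub finF] in simp_all)
      also have "\<dots> \<le> card (\<Union>F)" using sub finF by (rule card_mono[rotated])
      also have "\<dots> \<le> card F + family_dim F" using F simp by (intro card_Union_simplices_le)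
      finally show False using less by simp
    qed
    then show ?thesis using link_witness_remove_simplices[OF sc F(2) A(2)] by blast
  qed
  \<comment> \<open>The case of empty \<open>U\<close> and \<open>A\<close> supplies a vertex of
    \<open>?Y\<close>, as \<open>ample\<close> also demands a nonempty complex.\<close>
  have "\<exists>v. v \<in> link_witnesses ?Y {} {}"
    by (rule ex) (auto simp: simplicial_complex_def)
  then have "?Y \<noteq> {}" unfolding link_witnesses_def vertices_def by auto
  then show ?thesis
    using ex simplicial_complex_remove_simplices[OF sc] unfolding ample_def link_witnesses_def
    by blast
qed

theorem theorem3p1:
  fixes X Y F :: "'a set set" and r k :: nat
  assumes "k \<ge> 1" and "r > k"
    and "ample r X"
    and "finite F" and "F \<subseteq> X"
    and "Y = remove_simplices X F"
  shows "(card F + family_dim F < num_complexes k + k \<longrightarrow> ample (r - k) Y) \<and>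
         (card F + family_dim F < 2 ^ (k choose (k div 2)) + k \<longrightarrow> ample (r - k) Y)"
proof -
  have 1: "card F + family_dim F < num_complexes k + k \<longrightarrow> ample (r - k) Y"
    using assms ample_remove_simplices[of r X k F] by auto
  \<comment> \<open>For \<open>k = 1\<close> the middle layer \<open>k div 2\<close> consists of the empty set, which is no simplex;
    the complementary layer always avoids this.\<close>
  have "k choose (k div 2) = k choose (k - k div 2)"
    by (intro binomial_symmetric) simp
  then have "2 ^ (k choose (k div 2)) \<le> num_complexes k"
    using two_power_choose_le_num_complexes[of "k - k div 2" k] \<open>k \<ge> 1\<close> by simp
  with 1 show ?thesis by simp
qed

end
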